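(* For every integer $k \ge 1$, the edge set of the hypercube $Q_{2k+1}$ can be partitioned into the edge sets of $k$ pairwise edge-disjoint spanning trees of $Q_{2k+1}$ together with a set $R$ of remaining edges such that the graph formed by $R$ (with vertex set the set of endpoints of edges of $R$) is a forest with exactly $k$ connected components.
   Context: The $n$-dimensional hypercube $Q_n$ is the graph whose vertices are all binary vectors of length $n$, with two vertices adjacent if and only if they differ in exactly one coordinate. A forest is an acyclic graph. *)

theory Defs
  imports Main
begin

text \<open>Simple undirected graphs are given by a vertex set V and an edge set E,
  each edge being a two-element set of vertices.\<close>

definition hypercube_verts :: "nat \<Rightarrow> bool list set" where
  "hypercube_verts n = {xs. length xs = n}"

definition hypercube_adj :: "bool list \<Rightarrow> bool list \<Rightarrow> bool" where
  "hypercube_adj u v \<longleftrightarrow> length u = length v \<and>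
     card {i. i < length u \<and> u ! i \<noteq> v ! i} = 1"

definition hypercube_edges :: "nat \<Rightarrow> bool list set set" where
  "hypercube_edges n = {{u, v} | u v. u \<in> hypercube_verts n \<and> v \<in> hypercube_verts n
                                     \<and> hypercube_adj u v}"

definition simple_graph :: "'a set \<Rightarrow> 'a set set \<Rightarrow> bool" where
  "simple_graph V E \<longleftrightarrow> (\<forall>e\<in>E. \<exists>u v. e = {u, v} \<and> u \<in> V \<and> v \<in> V \<and> u \<noteq> v)"

definition adj_rel :: "'a set set \<Rightarrow> ('a \<times> 'a) set" where
  "adj_rel E = {(u, v). {u, v} \<in> E}"

definition reach_rel :: "'a set \<Rightarrow> 'a set set \<Rightarrow> ('a \<times> 'a) set" where
  "reach_rel V E = {(u, v). u \<in> V \<and> v \<in> V \<and> (u, v) \<in> (adj_rel E)\<^sup>*}"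

definition connected_graph :: "'a set \<Rightarrow> 'a set set \<Rightarrow> bool" where
  "connected_graph V E \<longleftrightarrow> (\<forall>u\<in>V. \<forall>v\<in>V. (u, v) \<in> (adj_rel E)\<^sup>*)"

text \<open>A cycle: a list of at least 3 distinct vertices, consecutive ones (cyclically) adjacent.\<close>
definition is_cycle :: "'a set set \<Rightarrow> 'a list \<Rightarrow> bool" where
  "is_cycle E vs \<longleftrightarrow> length vs \<ge> 3 \<and> distinct vs \<and>
     (\<forall>i < length vs. {vs ! i, vs ! ((i + 1) mod length vs)} \<in> E)"

definition forest :: "'a set \<Rightarrow> 'a set set \<Rightarrow> bool" where
  "forest V E \<longleftrightarrow> simple_graph V E \<and> \<not> (\<exists>vs. is_cycle E vs)"

definition spanning_tree :: "'a set \<Rightarrow> 'a set set \<Rightarrow> 'a set set \<Rightarrow> bool" where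
  "spanning_tree V E T \<longleftrightarrow> T \<subseteq> E \<and> forest V T \<and> connected_graph V T"

definition num_components :: "'a set \<Rightarrow> 'a set set \<Rightarrow> nat" where
  "num_components V E = card (V // reach_rel V E)"

end

theory Submission
  imports Defs
begin

text \<open>Even dimensions carry the induction: the edges of \<open>Q\<^sub>2\<^sub>k\<close> are covered by \<open>k\<close> spanning trees
  \<open>T\<^sub>0, \<dots>, T\<^sub>k\<^sub>-\<^sub>1\<close> together with a matching of \<open>k\<close> edges \<open>v\<^sub>i w\<^sub>i\<close>. Passing to four copies arranged
  in a 4-cycle, each \<open>T\<^sub>i\<close> with \<open>i > 0\<close> is taken in all copies and linked up by three edges over \<open>v\<^sub>i\<close>.
  The copies of \<open>T\<^sub>0\<close> and the remaining edges between copies form two new trees: each keeps \<open>T\<^sub>0\<close> in two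
  of the copies and reaches every vertex of the other two by an edge between copies. A vertex
  over \<open>v\<^sub>i\<close> whose edge has been given away is reached from \<open>w\<^sub>i\<close> along a copy of the matching instead.
  All but \<open>k + 1\<close> of the copied matching edges are used in this way.

  For \<open>Q\<^sub>2\<^sub>k\<^sub>+\<^sub>1\<close> take two copies. The tree \<open>T\<^sub>0\<close> of the first copy, extended to the second copy in the
  same manner, frees \<open>T\<^sub>0\<close> of the second copy. The rest consists of that tree, the matching of the
  first copy, and one edge joining the two, hence has \<open>k\<close> components. Since the edge numbers add up
  to that of the whole cube, covering already implies disjointness.\<close>

section \<open>Forests built by adding leaves\<close>

text \<open>The last argument counts the components.\<close>

inductive grown :: "'a set \<Rightarrow> 'a set set \<Rightarrow> nat \<Rightarrow> bool" where
  empty: "grown {} {} 0"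
| isolated: "grown V E c \<Longrightarrow> w \<notin> V \<Longrightarrow> grown (insert w V) E (Suc c)"
| leaf: "grown V E c \<Longrightarrow> u \<in> V \<Longrightarrow> w \<notin> V \<Longrightarrow> grown (insert w V) (insert {u, w} E) c"

lemma grown_finite: "grown V E c \<Longrightarrow> finite V \<and> finite E"
  by (induction rule: grown.induct) auto

lemma grown_simple_graph: "grown V E c \<Longrightarrow> simple_graph V E"
  unfolding simple_graph_def by (induction rule: grown.induct) (auto, metis+)

lemma grown_edge_subset:
  assumes "grown V E c" "e \<in> E"
  shows "e \<subseteq> V"
proof -
  from grown_simple_graph[OF assms(1)] assms(2) obtain u v where "e = {u, v}" "u \<in> V" "v \<in> V"
    unfolding simple_graph_def by meson
  then show ?thesis by simp
qed

text \<open>Supplies the edge counts that finally turn covering into disjointness. A leaf adds one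
  vertex and one edge, an isolated vertex adds one vertex and one component.\<close>

lemma grown_card: "grown V E c \<Longrightarrow> card E + c = card V"
proof (induction rule: grown.induct)
  case (leaf V E c u w)
  then have "{u, w} \<notin> E" using grown_edge_subset by blast
  with leaf show ?case using grown_finite[OF leaf(1)] by simp
next
  case (isolated V E c w)
  then show ?case using grown_finite[OF isolated(1)] by simp
qed simp

text \<open>A cycle through \<open>w\<close> would have two distinct neighbours of \<open>w\<close>
  on it, but the only edge at \<open>w\<close> leads to \<open>u\<close>. So the cycle avoids
  \<open>w\<close> and with it the new edge.\<close>

lemma cycle_insert_pendant:
  assumes E: "\<And>e. e \<in> E \<Longrightarrow> w \<notin> e" and cyc: "is_cycle (insert {u, w} E) vs"
  shows "is_cycle E vs"
proof -
  define n where "n = length vs"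
  have n: "n \<ge> 3" and d: "distinct vs"
    and e: "\<And>i. i < n \<Longrightarrow> {vs ! i, vs ! ((i + 1) mod n)} \<in> insert {u, w} E"
    using cyc by (auto simp: is_cycle_def n_def)
  have "w \<notin> set vs"
  proof
    assume "w \<in> set vs"
    then obtain i where i: "i < n" "vs ! i = w" by (auto simp: in_set_conv_nth n_def)
    \<comment> \<open>\<open>j\<close> and \<open>l\<close> are the cyclic predecessor and successor
      of position \<open>i\<close>; as the length is at least 3, the three positions are
      distinct.\<close>
    define j where "j = (if i = 0 then n - 1 else i - 1)"
    define l where "l = (if i = n - 1 then 0 else i + 1)"
    have j: "j < n" "(j + 1) mod n = i" using i n by (auto simp: j_def)
    have l: "l < n" "(i + 1) mod n = l" using i n by (auto simp: l_def)
    have ne: "j \<noteq> l" "l \<noteq> i" "j \<noteq> i" using i n by (auto simp: j_def l_def split: if_splits)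
    have "{w, vs ! l} = {u, w}" using e[OF i(1)] E[of "{w, vs ! l}"] i(2) l by auto
    moreover have "{vs ! j, w} = {u, w}" using e[OF j(1)] E[of "{vs ! j, w}"] i(2) j by auto
    moreover have "vs ! l \<noteq> w" "vs ! j \<noteq> w"
      using nth_eq_iff_index_eq[OF d] i j l ne by (auto simp: n_def)
    ultimately have "vs ! l = vs ! j" by (metis doubleton_eq_iff)
    then show False using nth_eq_iff_index_eq[OF d] j l ne by (auto simp: n_def)
  qed
  then have "{vs ! i, vs ! ((i + 1) mod n)} \<noteq> {u, w}" if "i < n" for i
    using that n by (metis insertI1 insertI2 insertE singletonD nth_mem n_def mod_less_divisor
        not_numeral_le_zero not_gr_zero)
  then show ?thesis using cyc e by (auto simp: is_cycle_def n_def)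
qed

lemma grown_forest:
  assumes "grown V E c"
  shows "forest V E"
proof -
  have "\<nexists>vs. is_cycle E vs"
    using assms
  proof (induction rule: grown.induct)
    case empty
    then show ?case
      by (auto simp: is_cycle_def) (metis length_greater_0_conv list.size(3) not_numeral_le_zero)
  next
    case (leaf V E c u w)
    then show ?case using cycle_insert_pendant[of E w u] grown_edge_subset by blast
  qed
  with assms show ?thesis by (simp add: forest_def grown_simple_graph)
qed

section \<open>Connectivity and components of grown graphs\<close>

lemma sym_adj_rel: "sym (adj_rel E)"
  by (auto simp: sym_def adj_rel_def insert_commute)

lemma adj_rel_rtrancl_mono: "E \<subseteq> F \<Longrightarrow> (adj_rel E)\<^sup>* \<subseteq> (adj_rel F)\<^sup>*"
  by (intro rtrancl_mono) (auto simp: adj_rel_def)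

lemma grown_labelling:
  assumes "grown V E c"
  shows "\<exists>f. f ` V = {..<c} \<and>
    (\<forall>u\<in>V. \<forall>v\<in>V. (u, v) \<in> (adj_rel E)\<^sup>* \<longleftrightarrow> f u = (f v :: nat))"
proof -
  \<comment> \<open>For the induction, invariance of labels along paths is replaced by invariance
    along single edges, which is easy to check after each growth step. An isolated vertex gets the
    fresh label \<open>c\<close>, a leaf inherits the label of its neighbour.\<close>
  have "\<exists>f. f ` V = {..<c} \<and> (\<forall>a b. {a, b} \<in> E \<longrightarrow> f a = f b) \<and>
    (\<forall>u\<in>V. \<forall>v\<in>V. f u = (f v :: nat) \<longrightarrow> (u, v) \<in> (adj_rel E)\<^sup>*)"
    using assms
  proof (induction rule: grown.induct)
    case (isolated V E c w)
    then obtain f where f: "f ` V = {..<c}" "\<forall>a b. {a, b} \<in> E \<longrightarrow> f a = f b"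
      "\<forall>u\<in>V. \<forall>v\<in>V. f u = (f v :: nat) \<longrightarrow> (u, v) \<in> (adj_rel E)\<^sup>*" by blast
    let ?f = "f(w := c)"
    have nw: "w \<noteq> a \<and> w \<noteq> b" if "{a, b} \<in> E" for a b
      using that grown_edge_subset[OF isolated(1) that] isolated(2) by auto
    have lt: "f x < c" if "x \<in> V" for x using f(1) that by blast
    have "?f ` insert w V = {..<Suc c}"
      using f(1) isolated(2) by (auto simp: lessThan_Suc)
    moreover have "\<forall>a b. {a, b} \<in> E \<longrightarrow> ?f a = ?f b"
      using f(2) nw by auto
    moreover have "(x, y) \<in> (adj_rel E)\<^sup>*"
      if "x \<in> insert w V" "y \<in> insert w V" "?f x = ?f y" for x y
      using that f(3) lt[of x] lt[of y] isolated(2) by (auto split: if_splits)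
    ultimately show ?case by blast
  next
    case (leaf V E c u w)
    then obtain f where f: "f ` V = {..<c}" "\<forall>a b. {a, b} \<in> E \<longrightarrow> f a = f b"
      "\<forall>u\<in>V. \<forall>v\<in>V. f u = (f v :: nat) \<longrightarrow> (u, v) \<in> (adj_rel E)\<^sup>*" by blast
    let ?E = "insert {u, w} E" and ?f = "f(w := f u)"
    have nw: "w \<noteq> a \<and> w \<noteq> b" if "{a, b} \<in> E" for a b
      using that grown_edge_subset[OF leaf(1) that] leaf(3) by auto
    have old: "(x, y) \<in> (adj_rel ?E)\<^sup>*" if "x \<in> V" "y \<in> V" "f x = f y" for x y
      using that f(3) adj_rel_rtrancl_mono[of E ?E] by blast
    have uw: "(u, w) \<in> adj_rel ?E" "(w, u) \<in> adj_rel ?E"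
      by (auto simp: adj_rel_def insert_commute)
    have "?f ` insert w V = {..<c}" using f(1) leaf(2,3) by auto
    moreover have "\<forall>a b. {a, b} \<in> ?E \<longrightarrow> ?f a = ?f b"
      using nw f(2) by (auto simp: doubleton_eq_iff)
    moreover have "(x, y) \<in> (adj_rel ?E)\<^sup>*"
      if "x \<in> insert w V" "y \<in> insert w V" "?f x = ?f y" for x y
    proof -
      have *: "(x, u) \<in> (adj_rel ?E)\<^sup>*" if "x \<in> insert w V" "?f x = f u" for x
        using that old[of x u] uw leaf(2,3) by (cases "x = w") auto
      have **: "(u, x) \<in> (adj_rel ?E)\<^sup>*" if "x \<in> insert w V" "?f x = f u" for x
        using * that sym_rtrancl[OF sym_adj_rel] by (metis symD)
      show ?thesis
      proof (cases "x = w \<or> y = w")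
        case True
        then have "?f x = f u" "?f y = f u" using that(3) by auto
        then show ?thesis using *[of x] **[of y] that by (metis rtrancl_trans)
      next
        case False
        then show ?thesis using old that by auto
      qed
    qed
    ultimately show ?case by blast
  qed auto
  then obtain f where f: "f ` V = {..<c}" "\<forall>a b. {a, b} \<in> E \<longrightarrow> f a = f b"
    "\<forall>u\<in>V. \<forall>v\<in>V. f u = (f v :: nat) \<longrightarrow> (u, v) \<in> (adj_rel E)\<^sup>*" by blast
  have "f u = f v" if "(u, v) \<in> (adj_rel E)\<^sup>*" for u v
    using that by induction (use f(2) in \<open>auto simp: adj_rel_def\<close>)
  then show ?thesis using f by blast
qed

text \<open>The components are the fibres of the labelling; fibres over attained labels are
  nonempty, so there are as many as labels.\<close>

lemma grown_num_components:
  assumes "grown V E c"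
  shows "num_components V E = c"
proof -
  obtain f where f: "f ` V = {..<c}"
    "\<forall>u\<in>V. \<forall>v\<in>V. (u, v) \<in> (adj_rel E)\<^sup>* \<longleftrightarrow> f u = (f v :: nat)"
    using grown_labelling[OF assms] by blast
  have "V // reach_rel V E = (\<lambda>i. {v \<in> V. f v = i}) ` f ` V"
  proof -
    have "reach_rel V E `` {u} = {v \<in> V. f v = f u}" if "u \<in> V" for u
      using f(2) that by (auto simp: reach_rel_def)
    then show ?thesis by (auto simp: quotient_def)
  qed
  moreover have "inj_on (\<lambda>i. {v \<in> V. f v = i}) (f ` V)"
    by (rule inj_onI) blast
  ultimately show ?thesis
    by (simp add: num_components_def card_image f(1))
qed

lemma grown_connected:
  assumes "grown V E 1"
  shows "connected_graph V E"
proof -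
  obtain f where f: "f ` V = {..<1}"
    "\<forall>u\<in>V. \<forall>v\<in>V. (u, v) \<in> (adj_rel E)\<^sup>* \<longleftrightarrow> f u = (f v :: nat)"
    using grown_labelling[OF assms] by blast
  then have "f u = 0" if "u \<in> V" for u using that by auto
  with f(2) show ?thesis by (auto simp: connected_graph_def)
qed

text \<open>Two distinct vertices rule out the one-vertex tree. Any vertex then has a path to
  another one, and the first edge of that path covers it.\<close>

lemma grown_Union:
  assumes "grown V E 1" "x \<in> V" "y \<in> V" "x \<noteq> y"
  shows "\<Union>E = V"
proof
  show "\<Union>E \<subseteq> V" using grown_edge_subset[OF assms(1)] by blast
  show "V \<subseteq> \<Union>E"
  proof
    fix a assume a: "a \<in> V"
    obtain b where b: "b \<in> V" "a \<noteq> b" using assms by metis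
    have "(a, b) \<in> (adj_rel E)\<^sup>*"
      using grown_connected[OF assms(1)] a b by (auto simp: connected_graph_def)
    then show "a \<in> \<Union>E"
      by (cases rule: converse_rtranclE) (use b in \<open>auto simp: adj_rel_def\<close>)
  qed
qed

section \<open>Combining grown graphs\<close>

lemma grown_image:
  assumes "grown V E c" "inj f"
  shows "grown (f ` V) ((`) f ` E) c"
  using assms(1)
proof (induction rule: grown.induct)
  case (isolated V E c w)
  then show ?case
    using grown.isolated[of "f ` V" "(`) f ` E" c "f w"] assms(2) by (simp add: inj_image_mem_iff)
next
  case (leaf V E c u w)
  then show ?case
    using grown.leaf[of "f ` V" "(`) f ` E" c "f u" "f w"] assms(2)
    by (simp add: inj_image_mem_iff)
qed (simp add: grown.empty)

lemma grown_disjoint_Un: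
  assumes "grown V2 E2 c2" "grown V1 E1 c1" "V1 \<inter> V2 = {}"
  shows "grown (V1 \<union> V2) (E1 \<union> E2) (c1 + c2)"
  using assms
proof (induction rule: grown.induct)
  case (isolated V E c w)
  then show ?case using grown.isolated[of "V1 \<union> V" "E1 \<union> E" "c1 + c" w] by auto
next
  case (leaf V E c u w)
  then show ?case using grown.leaf[of "V1 \<union> V" "E1 \<union> E" "c1 + c" u w] by auto
qed auto

lemma grown_pos: "grown V E c \<Longrightarrow> x \<in> V \<Longrightarrow> c > 0"
  by (induction arbitrary: x rule: grown.induct) auto

text \<open>The second graph is rebuilt on top of the first, the joining edge being inserted at the
  moment \<open>w\<close> appears. Generalising over the first graph lets it absorb \<open>w\<close>
  early.\<close>

lemma grown_join:
  assumes "grown V2 E2 c2" "grown V1 E1 c1" "V1 \<inter> V2 = {}" "u \<in> V1" "w \<in> V2"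
  shows "grown (V1 \<union> V2) (insert {u, w} (E1 \<union> E2)) (c1 + c2 - 1)"
  using assms
proof (induction arbitrary: V1 E1 u w rule: grown.induct)
  case (isolated V E c y)
  show ?case
  proof (cases "w = y")
    case True
    have "grown (insert y V1) (insert {u, y} E1) c1"
      using isolated by (intro grown.leaf) auto
    from grown_disjoint_Un[OF isolated(1) this] show ?thesis using isolated True by auto
  next
    case False
    \<comment> \<open>Positivity keeps the truncated subtraction \<open>c1 + c - 1\<close>
      exact.\<close>
    then have c: "c > 0" using isolated grown_pos[of V E c w] by auto
    have "grown (V1 \<union> V) (insert {u, w} (E1 \<union> E)) (c1 + c - 1)"
      using isolated False by (intro isolated.IH) auto
    then have "grown (insert y (V1 \<union> V)) (insert {u, w} (E1 \<union> E)) (Suc (c1 + c - 1))"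
      using isolated by (intro grown.isolated) auto
    then show ?thesis using c by auto
  qed
next
  case (leaf V E c x y)
  show ?case
  proof (cases "w = y")
    case True
    have "grown (insert y V1) (insert {u, y} E1) c1"
      using leaf by (intro grown.leaf) auto
    \<comment> \<open>With \<open>y\<close> moved into the first graph, its old leaf edge to
      \<open>x\<close> takes over as the joining edge.\<close>
    then have "grown (insert y V1 \<union> V) (insert {y, x} (insert {u, y} E1 \<union> E)) (c1 + c - 1)"
      using leaf by (intro leaf.IH) auto
    then show ?thesis using True by (simp add: insert_commute)
  next
    case False
    have "grown (V1 \<union> V) (insert {u, w} (E1 \<union> E)) (c1 + c - 1)"
      using leaf False by (intro leaf.IH) auto
    then have "grown (insert y (V1 \<union> V)) (insert {x, y} (insert {u, w} (E1 \<union> E))) (c1 + c - 1)"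
      using leaf by (intro grown.leaf) auto
    then show ?thesis by (simp add: insert_commute)
  qed
qed auto

lemma grown_attach_leaves:
  assumes "finite J" "grown V E c" "inj_on h J" "h ` J \<inter> V = {}" "f ` J \<subseteq> V"
  shows "grown (V \<union> h ` J) (E \<union> (\<lambda>i. {f i, h i}) ` J) c"
  using assms
proof (induction J)
  case (insert j J)
  then have "grown (insert (h j) (V \<union> h ` J)) (insert {f j, h j} (E \<union> (\<lambda>i. {f i, h i}) ` J)) c"
    by (intro grown.leaf) auto
  then show ?case by simp
qed auto

text \<open>The vertices of the new copy are leaves over \<open>a ` V\<close>, except those over \<open>v ` J\<close>, which are leaves
  over \<open>w ` J\<close> inside the new copy.\<close>

lemma grown_attach_copy:
  assumes G: "grown V' E' c" "a ` V \<subseteq> V'" "b ` V \<inter> V' = {}" and b: "inj b" and V: "finite V"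
    and J: "finite J" "inj_on v J" "v ` J \<subseteq> V" "w ` J \<subseteq> V" "v ` J \<inter> w ` J = {}"
  shows "grown (V' \<union> b ` V) (E' \<union> (\<lambda>x. {a x, b x}) ` (V - v ` J) \<union> (\<lambda>i. {b (w i), b (v i)}) ` J) c"
proof -
  have "grown (V' \<union> b ` (V - v ` J)) (E' \<union> (\<lambda>x. {a x, b x}) ` (V - v ` J)) c"
    using G V b by (intro grown_attach_leaves) (auto simp: inj_on_def)
  then have "grown (V' \<union> b ` (V - v ` J) \<union> (b \<circ> v) ` J)
     (E' \<union> (\<lambda>x. {a x, b x}) ` (V - v ` J) \<union> (\<lambda>i. {(b \<circ> w) i, (b \<circ> v) i}) ` J) c"
  proof (rule grown_attach_leaves[OF J(1)])
    show "inj_on (b \<circ> v) J" using J(2) b by (simp add: comp_inj_on inj_on_subset)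
    show "(b \<circ> v) ` J \<inter> (V' \<union> b ` (V - v ` J)) = {}"
      using J(3) G(3) b by (auto simp: inj_eq)
    show "(b \<circ> w) ` J \<subseteq> V' \<union> b ` (V - v ` J)"
    proof -
      \<comment> \<open>The neighbours \<open>b (w i)\<close> were already attached in the first
        round.\<close>
      have "w ` J \<subseteq> V - v ` J" using J(4,5) by blast
      then show ?thesis by (metis image_comp image_mono le_supI2)
    qed
  qed
  moreover have "V' \<union> b ` (V - v ` J) \<union> (b \<circ> v) ` J = V' \<union> b ` V"
    using J(3) unfolding image_comp[symmetric] by blast
  ultimately show ?thesis by (simp add: comp_def)
qed

lemma grown_matching:
  assumes "finite I" "inj_on v I" "inj_on w I" "v ` I \<inter> w ` I = {}"
  shows "grown (v ` I \<union> w ` I) ((\<lambda>i. {v i, w i}) ` I) (card I)"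
  using assms
proof (induction I)
  case empty
  then show ?case by (simp add: grown.empty)
next
  case (insert i I)
  then have "grown (insert (v i) (v ` I \<union> w ` I)) ((\<lambda>i. {v i, w i}) ` I) (Suc (card I))"
    by (intro grown.isolated) auto
  then have "grown (insert (w i) (insert (v i) (v ` I \<union> w ` I)))
      (insert {v i, w i} ((\<lambda>i. {v i, w i}) ` I)) (Suc (card I))"
    using insert by (intro grown.leaf) auto
  then show ?case using insert by (simp add: insert_commute)
qed

text \<open>Replacing \<open>A i\<close> by \<open>A i - A j\<close> leaves the union unchanged, so
  an overlap would make the union smaller than the sum of the cardinalities.\<close>

lemma card_UN_eq_sum_imp_disjoint:
  assumes "finite I" "\<And>i. i \<in> I \<Longrightarrow> finite (A i)"
    and le: "(\<Sum>i\<in>I. card (A i)) \<le> card (\<Union>i\<in>I. A i)"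
    and ij: "i \<in> I" "j \<in> I" "i \<noteq> j"
  shows "A i \<inter> A j = {}"
proof -
  have "(\<Union>i\<in>I. A i) = (A i - A j) \<union> (\<Union>l\<in>I - {i}. A l)" using ij by auto
  then have "card (\<Union>i\<in>I. A i) \<le> card (A i - A j) + card (\<Union>l\<in>I - {i}. A l)"
    by (metis card_Un_le)
  also have "\<dots> \<le> card (A i - A j) + (\<Sum>l\<in>I - {i}. card (A l))"
    using assms(1) by (intro add_left_mono card_UN_le) auto
  finally have "card (A i) \<le> card (A i - A j)"
    using le sum.remove[OF assms(1) ij(1), of "\<lambda>i. card (A i)"] by simp
  then have "A i - A j = A i"
    using assms(2)[OF ij(1)] by (intro card_seteq) auto
  then show ?thesis by blast
qed

section \<open>The hypercube\<close>

lemma hypercube_verts_0: "hypercube_verts 0 = {[]}"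
  by (auto simp: hypercube_verts_def)

lemma hypercube_verts_Suc:
  "hypercube_verts (Suc n) = (#) False ` hypercube_verts n \<union> (#) True ` hypercube_verts n"
  by (auto simp: hypercube_verts_def length_Suc_conv image_iff)

text \<open>The disagreements of the tails are shifted by one. Unequal heads already use up the
  single disagreement allowed, which forces equal tails.\<close>

lemma hypercube_adj_Cons:
  "hypercube_adj (a # x) (b # y) \<longleftrightarrow> (if a = b then hypercube_adj x y else x = y)"
proof (cases "length x = length y")
  case True
  let ?D = "{i. i < length x \<and> x ! i \<noteq> y ! i}"
  have "i \<in> {i. i < length (a # x) \<and> (a # x) ! i \<noteq> (b # y) ! i} \<longleftrightarrow>
      i \<in> (if a = b then {} else {0}) \<union> Suc ` ?D" for i
    by (cases i) auto
  then have "{i. i < length (a # x) \<and> (a # x) ! i \<noteq> (b # y) ! i} =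
      (if a = b then {} else {0}) \<union> Suc ` ?D" by blast
  then have "card {i. i < length (a # x) \<and> (a # x) ! i \<noteq> (b # y) ! i} =
      (if a = b then 0 else 1) + card ?D"
    by (simp add: card_image)
  moreover have "card ?D = 0 \<longleftrightarrow> x = y"
    using True by (auto intro: nth_equalityI)
  ultimately show ?thesis using True by (auto simp: hypercube_adj_def)
qed (auto simp: hypercube_adj_def)

lemma hypercube_edges_0: "hypercube_edges 0 = {}"
  by (auto simp: hypercube_edges_def hypercube_verts_def hypercube_adj_def)

lemma hypercube_edges_Suc:
  "hypercube_edges (Suc n) = (`) ((#) False) ` hypercube_edges n \<union> (`) ((#) True) ` hypercube_edges n
     \<union> (\<lambda>x. {False # x, True # x}) ` hypercube_verts n" (is "?L = ?R")
proof
  show "?L \<subseteq> ?R"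
  proof
    fix e assume "e \<in> ?L"
    then obtain a x b y where e: "e = {a # x, b # y}" "x \<in> hypercube_verts n" "y \<in> hypercube_verts n"
      "hypercube_adj (a # x) (b # y)"
      by (auto simp: hypercube_edges_def hypercube_verts_def length_Suc_conv)
    show "e \<in> ?R"
    proof (cases "a = b")
      case True
      with e have "{x, y} \<in> hypercube_edges n" "e = (#) a ` {x, y}"
        by (auto simp: hypercube_edges_def hypercube_adj_Cons)
      then have "e \<in> (`) ((#) a) ` hypercube_edges n" by (rule image_eqI[rotated])
      then show ?thesis by (cases a) simp_all
    next
      case False
      with e have "e = {False # x, True # x}" by (cases a; cases b) (auto simp: hypercube_adj_Cons)
      with e show ?thesis by blast
    qed
  qed
  have *: "(#) a ` e \<in> ?L" if "e \<in> hypercube_edges n" for a e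
  proof -
    from that obtain x y where "e = {x, y}" "x \<in> hypercube_verts n" "y \<in> hypercube_verts n"
      "hypercube_adj x y" by (auto simp: hypercube_edges_def)
    then have "(#) a ` e = {a # x, a # y}" "a # x \<in> hypercube_verts (Suc n)"
      "a # y \<in> hypercube_verts (Suc n)" "hypercube_adj (a # x) (a # y)"
      by (auto simp: hypercube_verts_def hypercube_adj_Cons)
    then show ?thesis unfolding hypercube_edges_def by blast
  qed
  have "{False # x, True # x} \<in> ?L" if "x \<in> hypercube_verts n" for x
  proof -
    have "hypercube_adj (False # x) (True # x)" "False # x \<in> hypercube_verts (Suc n)"
      "True # x \<in> hypercube_verts (Suc n)"
      using that by (auto simp: hypercube_verts_def hypercube_adj_Cons)
    then show ?thesis unfolding hypercube_edges_def by blast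
  qed
  with * show "?R \<subseteq> ?L" by (simp add: image_subset_iff)
qed

lemma finite_hypercube_verts: "finite (hypercube_verts n)"
  by (induction n) (auto simp: hypercube_verts_0 hypercube_verts_Suc)

lemma card_hypercube_verts: "card (hypercube_verts n) = 2 ^ n"
  using card_lists_length_eq[of "UNIV :: bool set" n] by (simp add: hypercube_verts_def)

lemma finite_hypercube_edges: "finite (hypercube_edges n)"
  by (induction n) (auto simp: hypercube_edges_0 hypercube_edges_Suc finite_hypercube_verts)

lemma card_hypercube_edges: "2 * card (hypercube_edges n) = n * 2 ^ n"
proof (induction n)
  case (Suc n)
  let ?E = "hypercube_edges n"
  let ?F = "(`) ((#) False) ` ?E" and ?T = "(`) ((#) True) ` ?E"
    and ?M = "(\<lambda>x. {False # x, True # x}) ` hypercube_verts n"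
  \<comment> \<open>An empty edge would have the same image in both copies.\<close>
  have ne: "e \<noteq> {}" if "e \<in> ?E" for e using that by (auto simp: hypercube_edges_def)
  have inj: "inj_on ((`) ((#) b)) ?E" for b :: bool
    by (intro inj_onI) (simp add: inj_image_eq_iff)
  have "?F \<inter> ?T = {}"
  proof (rule equals0I)
    fix e assume "e \<in> ?F \<inter> ?T"
    then obtain a b where ab: "a \<in> ?E" "e = (#) False ` a" "e = (#) True ` b" by auto
    obtain z where "z \<in> a" using ne[OF ab(1)] by auto
    then have "False # z \<in> (#) True ` b" using ab(2,3) by (metis imageI)
    then show False by auto
  qed
  moreover have "(?F \<union> ?T) \<inter> ?M = {}"
  proof (rule equals0I)
    fix e assume "e \<in> (?F \<union> ?T) \<inter> ?M"
    then obtain a b x where e: "e = (#) b ` a" "e = {False # x, True # x}" by auto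
    \<comment> \<open>A matching edge has an endpoint with each head, whereas an edge inside a copy
      has only one head.\<close>
    have "(\<not> b) # x \<in> e" unfolding e(2) by (cases b) simp_all
    then have "(\<not> b) # x \<in> (#) b ` a" unfolding e(1) .
    then show False by auto
  qed
  moreover have "card ?M = 2 ^ n"
    by (subst card_image) (auto simp: inj_on_def doubleton_eq_iff card_hypercube_verts)
  ultimately have "card (hypercube_edges (Suc n)) = 2 * card ?E + 2 ^ n"
    by (simp add: hypercube_edges_Suc card_Un_disjoint finite_hypercube_edges
        finite_hypercube_verts card_image[OF inj])
  with Suc show ?case by simp
qed (simp add: hypercube_edges_0)

section \<open>Decomposing the hypercube\<close>

text \<open>Disjointness is not required here: it follows from counting once the construction is complete.\<close>

definition tree_matching_cover ::
  "nat \<Rightarrow> nat \<Rightarrow> (nat \<Rightarrow> bool list set set) \<Rightarrow> (nat \<Rightarrow> bool list) \<Rightarrow> (nat \<Rightarrow> bool list) \<Rightarrow> bool" where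
  "tree_matching_cover n k T v w \<longleftrightarrow> (\<forall>i<k. grown (hypercube_verts n) (T i) 1) \<and>
     inj_on v {..<k} \<and> inj_on w {..<k} \<and> v ` {..<k} \<inter> w ` {..<k} = {} \<and>
     v ` {..<k} \<subseteq> hypercube_verts n \<and> w ` {..<k} \<subseteq> hypercube_verts n \<and>
     hypercube_edges n = (\<Union>i<k. T i) \<union> (\<lambda>i. {v i, w i}) ` {..<k}"

section \<open>Even dimensions, by induction\<close>

lemma tree_matching_cover_square: "\<exists>T v w. tree_matching_cover 2 1 T v w"
proof -
  \<comment> \<open>Three sides of the 4-cycle form the tree, the fourth side is the
    matching.\<close>
  let ?T = "{{[True, True], [True, False]}, {[False, True], [True, True]}, {[False, False], [False, True]}}"
  have "grown {[False, False]} {} 1"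
    using grown.isolated[OF grown.empty, of "[False, False]"] by simp
  then have "grown {[False, True], [False, False]} {{[False, False], [False, True]}} 1"
    by (rule grown.leaf) auto
  then have "grown {[True, True], [False, True], [False, False]}
      {{[False, True], [True, True]}, {[False, False], [False, True]}} 1"
    by (rule grown.leaf) auto
  then have "grown {[True, False], [True, True], [False, True], [False, False]} ?T 1"
    by (rule grown.leaf) auto
  moreover have "hypercube_verts 2 = {[True, False], [True, True], [False, True], [False, False]}"
    by (auto simp: numeral_2_eq_2 hypercube_verts_0 hypercube_verts_Suc)
  moreover have "hypercube_edges 2 = ?T \<union> {{[True, False], [False, False]}}"
    by (auto simp: numeral_2_eq_2 hypercube_edges_0 hypercube_edges_Suc hypercube_verts_0
        hypercube_verts_Suc insert_commute)
  ultimately have "tree_matching_cover 2 1 (\<lambda>_. ?T) (\<lambda>_. [True, False]) (\<lambda>_. [False, False])"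
    by (auto simp: tree_matching_cover_def lessThan_Suc)
  then show ?thesis by blast
qed

lemma tree_matching_cover_step:
  assumes "tree_matching_cover n k T v w" "k \<ge> 1"
  shows "\<exists>T' v' w'. tree_matching_cover (n + 2) (Suc k) T' v' w'"
proof -
  \<comment> \<open>The prefixes follow a Gray code, so \<open>q0\<close>, \<open>q1\<close>,
    \<open>q2\<close>, \<open>q3\<close> are the four copies in cyclic order.\<close>
  define q0 :: "bool list \<Rightarrow> bool list" where "q0 x = False # False # x" for x
  define q1 :: "bool list \<Rightarrow> bool list" where "q1 x = False # True # x" for x
  define q2 :: "bool list \<Rightarrow> bool list" where "q2 x = True # True # x" for x
  define q3 :: "bool list \<Rightarrow> bool list" where "q3 x = True # False # x" for x
  note q = q0_def q1_def q2_def q3_def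
  have inj: "inj q0" "inj q1" "inj q2" "inj q3" by (auto simp: inj_def q)
  let ?V = "hypercube_verts n" and ?I = "{..<k}" and ?J = "{1..<k}"
  have T: "grown ?V (T i) 1" if "i < k" for i
    using assms that by (auto simp: tree_matching_cover_def)
  have vw: "inj_on v ?I" "inj_on w ?I" "v ` ?I \<inter> w ` ?I = {}" "v ` ?I \<subseteq> ?V" "w ` ?I \<subseteq> ?V"
    and En: "hypercube_edges n = (\<Union>i<k. T i) \<union> (\<lambda>i. {v i, w i}) ` ?I"
    using assms by (auto simp: tree_matching_cover_def)
  have I: "?I = insert 0 ?J" using assms(2) by auto
  have vV: "v i \<in> ?V" if "i < k" for i using vw(4) that by auto
  have vwJ: "inj_on v ?J" "v ` ?J \<inter> w ` ?J = {}" "v ` ?J \<subseteq> ?V" "w ` ?J \<subseteq> ?V"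
    using vw unfolding I by auto
  have verts: "hypercube_verts (n + 2) = q0 ` ?V \<union> q1 ` ?V \<union> q2 ` ?V \<union> q3 ` ?V"
    by (auto simp: hypercube_verts_Suc q image_Un image_image numeral_2_eq_2)
  define X where "X = (`) q0 ` hypercube_edges n \<union> (`) q1 ` hypercube_edges n
     \<union> (`) q2 ` hypercube_edges n \<union> (`) q3 ` hypercube_edges n"
  define M where "M a b S = (\<lambda>x. {a x, b x}) ` S"
    for a b :: "bool list \<Rightarrow> bool list" and S :: "bool list set"
  have edges: "hypercube_edges (n + 2) = X \<union> M q0 q1 ?V \<union> M q1 q2 ?V \<union> M q2 q3 ?V \<union> M q3 q0 ?V"
    unfolding X_def M_def q
    by (simp add: numeral_2_eq_2 hypercube_edges_Suc hypercube_verts_Suc image_Un image_image)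
      (auto simp: insert_commute)
  define S where "S i = (`) q0 ` T i \<union> (`) q1 ` T i \<union> (`) q2 ` T i \<union> (`) q3 ` T i
     \<union> {{q0 (v i), q1 (v i)}, {q1 (v i), q2 (v i)}, {q2 (v i), q3 (v i)}}" for i
  \<comment> \<open>Between \<open>q1\<close> and \<open>q2\<close> only the edges over
    \<open>v i\<close> with \<open>i > 0\<close> are taken, by \<open>S i\<close>. Between
    \<open>q2\<close> and \<open>q3\<close> the edge over \<open>v 0\<close> is taken as well, since
    it joins the two halves of \<open>B\<close>; hence \<open>?I\<close> in place of
    \<open>?J\<close>.\<close>
  define A where "A = (insert {q0 (v 0), q1 (v 0)} ((`) q0 ` T 0 \<union> (`) q1 ` T 0))
     \<union> M q1 q2 (?V - v ` ?J) \<union> (\<lambda>i. {q2 (w i), q2 (v i)}) ` ?J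
     \<union> M q2 q3 (?V - v ` ?I) \<union> (\<lambda>i. {q3 (w i), q3 (v i)}) ` ?I"
  \<comment> \<open>No \<open>S i\<close> uses the edges from \<open>q3\<close> to
    \<open>q0\<close>, so all of them serve here. Between \<open>q0\<close> and \<open>q1\<close>
    those over \<open>v i\<close> belong to \<open>S i\<close> for \<open>i > 0\<close> and to
    \<open>A\<close> for \<open>i = 0\<close>.\<close>
  define B where "B = (insert {q2 (v 0), q3 (v 0)} ((`) q2 ` T 0 \<union> (`) q3 ` T 0))
     \<union> M q3 q0 ?V
     \<union> M q0 q1 (?V - v ` ?I) \<union> (\<lambda>i. {q1 (w i), q1 (v i)}) ` ?I"
  have disj: "q0 ` ?V \<inter> q1 ` ?V = {}" "(q0 ` ?V \<union> q1 ` ?V) \<inter> q2 ` ?V = {}"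
    "(q0 ` ?V \<union> q1 ` ?V \<union> q2 ` ?V) \<inter> q3 ` ?V = {}"
    "q2 ` ?V \<inter> q3 ` ?V = {}" "(q2 ` ?V \<union> q3 ` ?V) \<inter> q0 ` ?V = {}"
    "(q2 ` ?V \<union> q3 ` ?V \<union> q0 ` ?V) \<inter> q1 ` ?V = {}"
    by (auto simp: q)
  have k0: "0 < k" using assms by simp
  have S: "grown (hypercube_verts (n + 2)) (S i) 1" if i: "i < k" for i
  proof -
    note G = T[OF i, THEN grown_image]
    have "grown (q0 ` ?V \<union> q1 ` ?V)
        (insert {q0 (v i), q1 (v i)} ((`) q0 ` T i \<union> (`) q1 ` T i)) 1"
      using grown_join[OF G[OF inj(2)] G[OF inj(1)] disj(1), of "q0 (v i)" "q1 (v i)"] vV[OF i] by simp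
    from grown_join[OF G[OF inj(3)] this disj(2), of "q1 (v i)" "q2 (v i)"] vV[OF i]
    have "grown (q0 ` ?V \<union> q1 ` ?V \<union> q2 ` ?V) (insert {q1 (v i), q2 (v i)}
        (insert {q0 (v i), q1 (v i)} ((`) q0 ` T i \<union> (`) q1 ` T i) \<union> (`) q2 ` T i)) 1"
      by simp
    from grown_join[OF G[OF inj(4)] this disj(3), of "q2 (v i)" "q3 (v i)"] vV[OF i]
    show ?thesis unfolding verts S_def by (simp add: Un_ac insert_commute)
  qed
  note G0 = T[OF k0, THEN grown_image]
  have A: "grown (hypercube_verts (n + 2)) A 1"
  proof -
    have "grown (q0 ` ?V \<union> q1 ` ?V)
        (insert {q0 (v 0), q1 (v 0)} ((`) q0 ` T 0 \<union> (`) q1 ` T 0)) 1"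
      using grown_join[OF G0[OF inj(2)] G0[OF inj(1)] disj(1), of "q0 (v 0)" "q1 (v 0)"] vV[OF k0]
      by simp
    from grown_attach_copy[where a = q1 and J = ?J and v = v and w = w,
        OF this _ _ inj(3) finite_hypercube_verts] disj(2) vwJ
    have "grown (q0 ` ?V \<union> q1 ` ?V \<union> q2 ` ?V)
        (insert {q0 (v 0), q1 (v 0)} ((`) q0 ` T 0 \<union> (`) q1 ` T 0)
          \<union> M q1 q2 (?V - v ` ?J) \<union> (\<lambda>i. {q2 (w i), q2 (v i)}) ` ?J) 1"
      unfolding M_def by (simp add: Int_commute)
    from grown_attach_copy[where a = q2 and J = ?I and v = v and w = w,
        OF this _ _ inj(4) finite_hypercube_verts] disj(3) vw
    show ?thesis unfolding verts A_def M_def by (simp add: Int_commute)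
  qed
  have B: "grown (hypercube_verts (n + 2)) B 1"
  proof -
    have "grown (q2 ` ?V \<union> q3 ` ?V)
        (insert {q2 (v 0), q3 (v 0)} ((`) q2 ` T 0 \<union> (`) q3 ` T 0)) 1"
      using grown_join[OF G0[OF inj(4)] G0[OF inj(3)] disj(4), of "q2 (v 0)" "q3 (v 0)"] vV[OF k0]
      by simp
    from grown_attach_copy[where a = q3 and J = "{}" and v = v and w = w,
        OF this _ _ inj(1) finite_hypercube_verts] disj(5)
    have "grown (q2 ` ?V \<union> q3 ` ?V \<union> q0 ` ?V)
        (insert {q2 (v 0), q3 (v 0)} ((`) q2 ` T 0 \<union> (`) q3 ` T 0) \<union> M q3 q0 ?V) 1"
      unfolding M_def by (simp add: Int_commute)
    from grown_attach_copy[where a = q0 and J = ?I and v = v and w = w,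
        OF this _ _ inj(2) finite_hypercube_verts] disj(6) vw
    show ?thesis unfolding verts B_def M_def by (simp add: Int_commute Un_ac)
  qed
  \<comment> \<open>\<open>A\<close> replaces the tree with index 0 and \<open>B\<close> takes the
    new index \<open>k\<close>.\<close>
  define T' where "T' i = (if i = 0 then A else if i = k then B else S i)" for i
  \<comment> \<open>Left over are the whole matching in copy \<open>q0\<close> and, as
    \<open>A\<close> uses only \<open>?J\<close> in \<open>q2\<close>, the edge with index 0
    there.\<close>
  define v' where "v' i = (if i < k then q0 (v i) else q2 (v 0))" for i
  define w' where "w' i = (if i < k then q0 (w i) else q2 (w 0))" for i
  have TU: "(\<Union>i<Suc k. T' i) = A \<union> B \<union> (\<Union>i\<in>?J. S i)"
    unfolding lessThan_Suc I T'_def using assms(2) by auto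
  have PU: "(\<lambda>i. {v' i, w' i}) ` {..<Suc k} =
      insert {q2 (v 0), q2 (w 0)} ((\<lambda>i. {q0 (v i), q0 (w i)}) ` ?I)"
    unfolding lessThan_Suc by (auto simp: v'_def w'_def)
  have qE: "(`) f ` hypercube_edges n = (`) f ` T 0 \<union> (\<Union>i\<in>?J. (`) f ` T i)
      \<union> insert {f (v 0), f (w 0)} ((\<lambda>i. {f (v i), f (w i)}) ` ?J)"
    for f :: "bool list \<Rightarrow> bool list"
    unfolding En I by (simp add: image_Un image_UN image_image)
  have split: "M a b ?V = M a b (?V - v ` K) \<union> (\<lambda>i. {a (v i), b (v i)}) ` K"
    if "K \<subseteq> ?I" for a b K
  proof -
    have "?V = (?V - v ` K) \<union> v ` K" using that vw(4) by blast
    from arg_cong[OF this, of "(`) (\<lambda>x. {a x, b x})"] show ?thesis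
      by (simp only: M_def image_Un image_image)
  qed
  have comm: "(\<lambda>i. {f (w i), f (v i)}) = (\<lambda>i. {f (v i), f (w i)})"
    for f :: "bool list \<Rightarrow> bool list" by (simp add: insert_commute)
  have SU: "(\<Union>i\<in>?J. S i) = (\<Union>i\<in>?J. (`) q0 ` T i) \<union> (\<Union>i\<in>?J. (`) q1 ` T i)
      \<union> (\<Union>i\<in>?J. (`) q2 ` T i) \<union> (\<Union>i\<in>?J. (`) q3 ` T i)
      \<union> (\<lambda>i. {q0 (v i), q1 (v i)}) ` ?J \<union> (\<lambda>i. {q1 (v i), q2 (v i)}) ` ?J
      \<union> (\<lambda>i. {q2 (v i), q3 (v i)}) ` ?J"
    unfolding S_def by auto
  \<comment> \<open>After the edges over the \<open>v i\<close> are split off, both sides are unions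
    of the same pieces, up to order and repetition.\<close>
  have "hypercube_edges (n + 2) = (\<Union>i<Suc k. T' i) \<union> (\<lambda>i. {v' i, w' i}) ` {..<Suc k}"
    unfolding edges TU PU X_def qE A_def B_def SU comm
      split[OF order_refl, of q0 q1] split[OF order_refl, of q2 q3]
      split[of ?J q1 q2, OF I[THEN equalityD2, THEN subset_insertI[THEN order_trans]]]
    unfolding I by (simp only: image_insert Un_insert_left Un_insert_right Un_assoc Un_commute
        Un_left_commute insert_commute Un_absorb Un_left_absorb insert_absorb2)
  moreover have "grown (hypercube_verts (n + 2)) (T' i) 1" if "i < Suc k" for i
    using that A B S by (auto simp: T'_def)
  moreover have "inj_on v' {..<Suc k}" "inj_on w' {..<Suc k}"
    using vw(1,2) by (auto simp: inj_on_def v'_def w'_def q)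
  moreover have "v' ` {..<Suc k} \<inter> w' ` {..<Suc k} = {}"
    using vw(3) k0 by (auto simp: v'_def w'_def q)
  moreover have "v' ` {..<Suc k} \<subseteq> hypercube_verts (n + 2)" "w' ` {..<Suc k} \<subseteq> hypercube_verts (n + 2)"
    using vw(4,5) k0 unfolding verts by (auto simp: v'_def w'_def)
  ultimately show ?thesis unfolding tree_matching_cover_def by blast
qed

lemma tree_matching_cover_exists:
  assumes "k \<ge> 1"
  shows "\<exists>T v w. tree_matching_cover (2 * k) k T v w"
  using assms
proof (induction k rule: dec_induct)
  case base
  then show ?case using tree_matching_cover_square by simp
next
  case (step k)
  then show ?case using tree_matching_cover_step[of "2 * k" k] by auto
qed

section \<open>Odd dimensions, from two copies of the even cube\<close>

theorem mainTheorem4: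
  fixes k :: nat
  assumes "k \<ge> 1"
  shows "\<exists>(T :: nat \<Rightarrow> bool list set set) (R :: bool list set set).
     (\<forall>i<k. spanning_tree (hypercube_verts (2*k+1)) (hypercube_edges (2*k+1)) (T i))
   \<and> (\<forall>i<k. \<forall>j<k. i \<noteq> j \<longrightarrow> T i \<inter> T j = {})
   \<and> (\<forall>i<k. T i \<inter> R = {})
   \<and> (\<Union>i<k. T i) \<union> R = hypercube_edges (2*k+1)
   \<and> forest (\<Union>R) R
   \<and> num_components (\<Union>R) R = k"
proof -
  obtain T v w where "tree_matching_cover (2 * k) k T v w"
    using tree_matching_cover_exists[OF assms] by blast
  define n where "n = 2 * k"
  let ?V = "hypercube_verts n" and ?I = "{..<k}"
  have T: "grown ?V (T i) 1" if "i < k" for i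
    using \<open>tree_matching_cover _ _ _ _ _\<close> that by (auto simp: tree_matching_cover_def n_def)
  have vw: "inj_on v ?I" "inj_on w ?I" "v ` ?I \<inter> w ` ?I = {}" "v ` ?I \<subseteq> ?V" "w ` ?I \<subseteq> ?V"
    and En: "hypercube_edges n = (\<Union>i<k. T i) \<union> (\<lambda>i. {v i, w i}) ` ?I"
    using \<open>tree_matching_cover _ _ _ _ _\<close> by (auto simp: tree_matching_cover_def n_def)
  have I: "?I = insert 0 {1..<k}" and k0: "0 < k" using assms by auto
  have vV: "v i \<in> ?V" if "i < k" for i using vw(4) that by auto
  define p where "p = (#) False"
  define q where "q = (#) True"
  have inj: "inj p" "inj q" by (auto simp: p_def q_def)
  have disj: "p ` A \<inter> q ` B = {}" "q ` A \<inter> p ` B = {}" for A B by (auto simp: p_def q_def)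
  have verts: "hypercube_verts (Suc n) = p ` ?V \<union> q ` ?V"
    by (simp add: hypercube_verts_Suc p_def q_def)
  have edges: "hypercube_edges (Suc n) = (`) p ` hypercube_edges n \<union> (`) q ` hypercube_edges n
     \<union> (\<lambda>x. {p x, q x}) ` ?V"
    by (simp add: hypercube_edges_Suc p_def q_def)
  \<comment> \<open>Of the edges between the copies, those over \<open>v i\<close> go to
    \<open>S i\<close> for \<open>i > 0\<close> and to \<open>R\<close> for \<open>i = 0\<close>.
    The vertices \<open>q (v i)\<close> are reached along the matching of the second copy
    instead.\<close>
  define A where "A = (`) p ` T 0 \<union> (\<lambda>x. {p x, q x}) ` (?V - v ` ?I) \<union> (\<lambda>i. {q (w i), q (v i)}) ` ?I"
  define S where "S i = insert {p (v i), q (v i)} ((`) p ` T i \<union> (`) q ` T i)" for i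
  define T' where "T' i = (if i = 0 then A else S i)" for i
  define R where "R = insert {q (v 0), p (v 0)} ((`) q ` T 0 \<union> (\<lambda>i. {p (v i), p (w i)}) ` ?I)"
  define VR where "VR = q ` ?V \<union> (p ` v ` ?I \<union> p ` w ` ?I)"
  have A: "grown (hypercube_verts (Suc n)) A 1"
    unfolding verts A_def
    using grown_attach_copy[where a = p and J = ?I and v = v and w = w,
        OF grown_image[OF T[OF k0] inj(1)] _ _ inj(2) finite_hypercube_verts] vw disj by simp
  have S: "grown (hypercube_verts (Suc n)) (S i) 1" if "i < k" for i
    unfolding verts S_def
    using grown_join[OF T[OF that, THEN grown_image, OF inj(2)] T[OF that, THEN grown_image, OF inj(1)]
        disj(1), of "p (v i)" "q (v i)"] vV[OF that] by simp
  have T': "grown (hypercube_verts (Suc n)) (T' i) 1" if "i < k" for i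
    using A S that by (auto simp: T'_def)
  have "grown (p ` v ` ?I \<union> p ` w ` ?I) ((\<lambda>i. {p (v i), p (w i)}) ` ?I) k"
    using grown_image[OF grown_matching[OF finite_lessThan vw(1-3)] inj(1)]
    by (simp add: image_Un image_image)
  \<comment> \<open>The matching has \<open>k\<close> components and the tree one; the joining edge
    merges two of these \<open>k + 1\<close>.\<close>
  from grown_join[OF this grown_image[OF T[OF k0] inj(2)], of "q (v 0)" "p (v 0)"]
  have R: "grown VR R k"
    unfolding R_def VR_def using disj vV[OF k0] k0 by (simp add: image_Un[symmetric])
  have "v 0 \<in> ?V" "w 0 \<in> ?V" "v 0 \<noteq> w 0" using vw(3-5) unfolding I by auto
  then have "\<Union>((`) q ` T 0) = q ` ?V"
    by (intro grown_Union[OF grown_image[OF T[OF k0] inj(2)], of "q (v 0)" "q (w 0)"])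
      (simp_all add: inj_eq inj)
  then have UR: "\<Union>R = VR"
    using k0 vV unfolding R_def VR_def by auto
  have TU: "(\<Union>i<k. T' i) = A \<union> (\<Union>i\<in>{1..<k}. S i)"
    unfolding I T'_def by auto
  have qE: "(`) f ` hypercube_edges n = (`) f ` T 0 \<union> (\<Union>i\<in>{1..<k}. (`) f ` T i)
      \<union> insert {f (v 0), f (w 0)} ((\<lambda>i. {f (v i), f (w i)}) ` {1..<k})"
    for f :: "bool list \<Rightarrow> bool list"
    unfolding En I by (simp add: image_Un image_UN image_image)
  have split: "(\<lambda>x. {p x, q x}) ` ?V =
      (\<lambda>x. {p x, q x}) ` (?V - v ` ?I) \<union> (\<lambda>i. {p (v i), q (v i)}) ` ?I"
  proof -
    have "?V = (?V - v ` ?I) \<union> v ` ?I" using vw(4) by blast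
    from arg_cong[OF this, of "(`) (\<lambda>x. {p x, q x})"] show ?thesis
      by (simp only: image_Un image_image)
  qed
  have SU: "(\<Union>i\<in>{1..<k}. S i) = (\<Union>i\<in>{1..<k}. (`) p ` T i) \<union> (\<Union>i\<in>{1..<k}. (`) q ` T i)
      \<union> (\<lambda>i. {p (v i), q (v i)}) ` {1..<k}"
    unfolding S_def by auto
  have comm: "(\<lambda>i. {q (w i), q (v i)}) = (\<lambda>i. {q (v i), q (w i)})"
    by (simp add: insert_commute)
  have cover: "(\<Union>i<k. T' i) \<union> R = hypercube_edges (Suc n)"
    unfolding TU edges qE split A_def SU R_def comm
    unfolding I by (simp only: image_insert Un_insert_left Un_insert_right Un_assoc Un_commute
        Un_left_commute insert_commute Un_absorb Un_left_absorb insert_absorb2)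
  \<comment> \<open>Listing \<open>R\<close> behind the trees lets one counting argument give all
    disjointness claims.\<close>
  define F where "F i = (if i = k then R else T' i)" for i
  have UF: "(\<Union>i<Suc k. F i) = hypercube_edges (Suc n)"
    unfolding lessThan_Suc cover[symmetric] by (auto simp: F_def)
  have cT: "card (T' i) = 2 * 2 ^ n - 1" if "i < k" for i
    using grown_card[OF T'[OF that]] by (simp add: card_hypercube_verts)
  have "card VR = 2 ^ n + (k + k)"
  proof -
    have "card (p ` v ` ?I \<union> p ` w ` ?I) = card (p ` v ` ?I) + card (p ` w ` ?I)"
      using vw(3) inj(1) by (intro card_Un_disjoint) (auto simp: inj_eq)
    moreover have "card VR = card (q ` ?V) + card (p ` v ` ?I \<union> p ` w ` ?I)"
      unfolding VR_def
      by (intro card_Un_disjoint) (use disj in \<open>auto simp: finite_hypercube_verts\<close>)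
    ultimately show ?thesis
      using inj vw by (simp add: card_image inj_on_subset card_hypercube_verts)
  qed
  then have cR: "card R = 2 ^ n + k" using grown_card[OF R] by simp
  have "(\<Sum>i<Suc k. card (F i)) = k * (2 * 2 ^ n - 1) + (2 ^ n + k)"
    by (simp add: F_def cT cR)
  also have "\<dots> = card (hypercube_edges (Suc n))"
  proof -
    \<comment> \<open>The \<open>k\<close> extra edges of \<open>R\<close> make up for the
      \<open>- 1\<close> in each tree, leaving \<open>(2 * k + 1) * 2 ^ n\<close>, the size of the
      edge set.\<close>
    have "k * (2 * 2 ^ n - 1) + k = k * (2 * 2 ^ n)"
      unfolding mult_Suc_right[symmetric] add.commute[of _ k] by simp
    moreover have "2 * card (hypercube_edges (Suc n)) = 2 * (k * (2 * 2 ^ n)) + 2 * 2 ^ n"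
      using card_hypercube_edges[of "Suc n"] by (simp add: n_def algebra_simps)
    ultimately show ?thesis by linarith
  qed
  finally have sum: "(\<Sum>i<Suc k. card (F i)) \<le> card (\<Union>i<Suc k. F i)" unfolding UF by simp
  have "finite (F i)" if "i < Suc k" for i
    using UF finite_hypercube_edges[of "Suc n"] that by (metis UN_upper finite_subset lessThan_iff)
  then have disjF: "F i \<inter> F j = {}" if "i < Suc k" "j < Suc k" "i \<noteq> j" for i j
    using card_UN_eq_sum_imp_disjoint[OF _ _ sum, of i j] that by simp
  have "T' i \<inter> T' j = {}" if "i < k" "j < k" "i \<noteq> j" for i j
    using disjF[of i j] that by (simp add: F_def)
  moreover have "T' i \<inter> R = {}" if "i < k" for i
    using disjF[of i k] that by (simp add: F_def)
  moreover have "spanning_tree (hypercube_verts (Suc n)) (hypercube_edges (Suc n)) (T' i)"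
    if "i < k" for i
    using T'[OF that] cover that
    by (auto simp: spanning_tree_def grown_forest grown_connected)
  moreover have "forest (\<Union>R) R" "num_components (\<Union>R) R = k"
    using R by (simp_all add: UR grown_forest grown_num_components)
  ultimately show ?thesis using cover unfolding n_def by (intro exI[of _ T'] exI[of _ R]) simp
qed

end
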